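(* For every $n\ge 1$, every $\varepsilon\in(0,(2n)^{-1}]$, and every finite subset $\mathcal{M}\subset\mathcal{D}_{n,\varepsilon}$, the semigroup $\operatorname{cl}\langle\mathcal{M}\rangle$ is finitely generated and profinite.
   Context: $\mathcal{D}_n$ is the set of $n\times n$ doubly stochastic matrices (non-negative real, every row and column sums to $1$). For $\varepsilon\in(0,(2n)^{-1}]$, a matrix $M\in\mathcal{D}_n$ is $\varepsilon$-domestic if there do not exist subsets $X,Y\subseteq\{1,\ldots,n\}$ with $X\neq Y$, $|X|=|Y|$ and $\sum_{i\in X,j\in Y}M[i,j]>(1-\varepsilon)|X|$. $\mathcal{D}_{n,\varepsilon}$ is the set of all $\varepsilon$-domestic matrices in $\mathcal{D}_n$; it is a topological semigroup (containing the identity matrix) under matrix multiplication with the standard topology. $\langle\mathcal{M}\rangle$ is the subsemigroup generated by $\mathcal{M}$, by convention also containing the identity; $\operatorname{cl}$ is topological closure (the closure of a subsemigroup of a topological semigroup is a subsemigroup). Finitely generated means equal to $\langle F\rangle$ for some finite set $F$. A topological semigroup is profinite if it is a projective limit of finite discrete semigroups. *)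

theory Defs
  imports "HOL-Analysis.Analysis"
begin

definition doubly_stochastic :: "(real ^ 'n ^ 'n) set" where
  "doubly_stochastic = {A. (\<forall>i j. A $ i $ j \<ge> 0) \<and>
     (\<forall>i. (\<Sum>j\<in>UNIV. A $ i $ j) = 1) \<and> (\<forall>j. (\<Sum>i\<in>UNIV. A $ i $ j) = 1)}"

definition domestic_matrices :: "real \<Rightarrow> (real ^ 'n ^ 'n) set" where
  "domestic_matrices \<epsilon> = {A \<in> doubly_stochastic.
     \<not> (\<exists>X Y. X \<noteq> Y \<and> card X = card Y \<and>
            (\<Sum>i\<in>X. \<Sum>j\<in>Y. A $ i $ j) > (1 - \<epsilon>) * real (card X))}"

inductive_set generated_semigroup :: "(real ^ 'n ^ 'n) set \<Rightarrow> (real ^ 'n ^ 'n) set"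
  for \<M> :: "(real ^ 'n ^ 'n) set" where
  identity: "mat 1 \<in> generated_semigroup \<M>"
| generator: "A \<in> \<M> \<Longrightarrow> A \<in> generated_semigroup \<M>"
| product: "A \<in> generated_semigroup \<M> \<Longrightarrow> B \<in> generated_semigroup \<M> \<Longrightarrow>
    A ** B \<in> generated_semigroup \<M>"

definition finitely_generated :: "(real ^ 'n ^ 'n) set \<Rightarrow> bool" where
  "finitely_generated S \<longleftrightarrow> (\<exists>F. finite F \<and> S = generated_semigroup F)"

definition semigroup_on :: "'a set \<Rightarrow> ('a \<Rightarrow> 'a \<Rightarrow> 'a) \<Rightarrow> bool" where
  "semigroup_on S f \<longleftrightarrow> (\<forall>x\<in>S. \<forall>y\<in>S. f x y \<in> S) \<and>
     (\<forall>x\<in>S. \<forall>y\<in>S. \<forall>z\<in>S. f (f x y) z = f x (f y z))"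

definition semigroup_hom_on ::
  "'a set \<Rightarrow> ('a \<Rightarrow> 'a \<Rightarrow> 'a) \<Rightarrow> 'b set \<Rightarrow> ('b \<Rightarrow> 'b \<Rightarrow> 'b) \<Rightarrow> ('a \<Rightarrow> 'b) \<Rightarrow> bool" where
  "semigroup_hom_on S f T g h \<longleftrightarrow>
     h \<in> S \<rightarrow> T \<and> (\<forall>x\<in>S. \<forall>y\<in>S. h (f x y) = g (h x) (h y))"

definition topological_semigroup :: "'a topology \<Rightarrow> ('a \<Rightarrow> 'a \<Rightarrow> 'a) \<Rightarrow> bool" where
  "topological_semigroup X f \<longleftrightarrow> semigroup_on (topspace X) f \<and>
     continuous_map (prod_topology X X) X (\<lambda>(x, y). f x y)"

text \<open>Inverse system of finite semigroups \<open>(T i, g i)\<close> over a directed preordered set \<open>(I, le)\<close>;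
  \<open>p i j\<close> is the connecting map \<open>T j \<rightarrow> T i\<close> for \<open>le i j\<close>.\<close>

locale finite_semigroup_inverse_system =
  fixes I :: "'i set" and le :: "'i \<Rightarrow> 'i \<Rightarrow> bool"
    and T :: "'i \<Rightarrow> 't set" and g :: "'i \<Rightarrow> 't \<Rightarrow> 't \<Rightarrow> 't"
    and p :: "'i \<Rightarrow> 'i \<Rightarrow> 't \<Rightarrow> 't"
  assumes nonempty: "I \<noteq> {}"
    and le_refl: "i \<in> I \<Longrightarrow> le i i"
    and le_trans: "\<lbrakk>i \<in> I; j \<in> I; k \<in> I; le i j; le j k\<rbrakk> \<Longrightarrow> le i k"
    and directed: "\<lbrakk>i \<in> I; j \<in> I\<rbrakk> \<Longrightarrow> \<exists>k\<in>I. le i k \<and> le j k"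
    and finite_carrier: "i \<in> I \<Longrightarrow> finite (T i)"
    and semigroup: "i \<in> I \<Longrightarrow> semigroup_on (T i) (g i)"
    and connecting_hom: "\<lbrakk>i \<in> I; j \<in> I; le i j\<rbrakk> \<Longrightarrow> semigroup_hom_on (T j) (g j) (T i) (g i) (p i j)"
    and connecting_id: "\<lbrakk>i \<in> I; x \<in> T i\<rbrakk> \<Longrightarrow> p i i x = x"
    and connecting_comp: "\<lbrakk>i \<in> I; j \<in> I; k \<in> I; le i j; le j k; x \<in> T k\<rbrakk> \<Longrightarrow> p i j (p j k x) = p i k x"

definition projective_limit ::
  "'i set \<Rightarrow> ('i \<Rightarrow> 'i \<Rightarrow> bool) \<Rightarrow> ('i \<Rightarrow> 't set) \<Rightarrow> ('i \<Rightarrow> 'i \<Rightarrow> 't \<Rightarrow> 't) \<Rightarrow> ('i \<Rightarrow> 't) set" where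
  "projective_limit I le T p =
     {x \<in> PiE I T. \<forall>i\<in>I. \<forall>j\<in>I. le i j \<longrightarrow> p i j (x j) = x i}"

definition projective_limit_topology ::
  "'i set \<Rightarrow> ('i \<Rightarrow> 'i \<Rightarrow> bool) \<Rightarrow> ('i \<Rightarrow> 't set) \<Rightarrow> ('i \<Rightarrow> 'i \<Rightarrow> 't \<Rightarrow> 't) \<Rightarrow> ('i \<Rightarrow> 't) topology" where
  "projective_limit_topology I le T p =
     subtopology (product_topology (\<lambda>i. discrete_topology (T i)) I) (projective_limit I le T p)"

definition projective_limit_mult ::
  "'i set \<Rightarrow> ('i \<Rightarrow> 't \<Rightarrow> 't \<Rightarrow> 't) \<Rightarrow> ('i \<Rightarrow> 't) \<Rightarrow> ('i \<Rightarrow> 't) \<Rightarrow> ('i \<Rightarrow> 't)" where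
  "projective_limit_mult I g x y = (\<lambda>i\<in>I. g i (x i) (y i))"

text \<open>HOL cannot quantify over types, so the types of the inverse system are fixed, without loss
  of generality: every finite semigroup is isomorphic to one with carrier in \<open>nat\<close>, and every
  profinite semigroup is the projective limit of its quotients by the clopen congruences of
  finite index, which are elements of the index type \<open>('a \<times> 'a) set\<close>.\<close>

definition profinite_semigroup :: "'a topology \<Rightarrow> ('a \<Rightarrow> 'a \<Rightarrow> 'a) \<Rightarrow> bool" where
  "profinite_semigroup X f \<longleftrightarrow> topological_semigroup X f \<and>
     (\<exists>(I :: ('a \<times> 'a) set set) le (T :: ('a \<times> 'a) set \<Rightarrow> nat set) g p h.
        finite_semigroup_inverse_system I le T g p \<and>
        homeomorphic_map X (projective_limit_topology I le T p) h \<and>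
        semigroup_hom_on (topspace X) f (projective_limit I le T p) (projective_limit_mult I g) h)"

end

theory Submission
  imports Defs
begin

text \<open>
  A domestic matrix \<open>A\<close> does not increase the Euclidean norm, and \<open>\<parallel>A x\<parallel> = \<parallel>x\<parallel>\<close> forces
  \<open>A x = x\<close>: equality makes every level set of \<open>A x\<close> and the corresponding level set of \<open>x\<close> a
  pair \<open>X, Y\<close> of equal size carrying the full mass \<open>|X|\<close>, so \<open>X = Y\<close>.

  For a finite set \<open>N\<close> of such matrices, all words using every letter of \<open>N\<close> contract the
  orthogonal complement of the common fixed space by one constant \<open>q < 1\<close>. A word using every
  letter has a suffix \<open>a c\<close> in which \<open>c\<close> uses exactly the letters other than \<open>a\<close>. Splitting off
  such blocks over and over, a limit of words either is a product of letters and of limits of words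
  over proper subsets of \<open>N\<close>, or annihilates the orthogonal complement and so is the projection
  onto the common fixed space. By induction on \<open>N\<close> the closure is finitely generated.

  In particular the closure is countable and compact, hence totally disconnected. In a compact
  semigroup every clopen set is a union of classes of an open congruence, and the quotients by open
  congruences are finite. Total disconnectedness makes them separate points, so the semigroup is
  their projective limit.
\<close>

section \<open>Domestic matrices are paracontracting\<close>

definition nonexpansive_matrices :: "(real ^ 'n ^ 'm) set" where
  "nonexpansive_matrices = {A. \<forall>x. norm (A *v x) \<le> norm x}"

definition paracontracting_matrices :: "(real ^ 'n ^ 'n) set" where
  "paracontracting_matrices =
     {A \<in> nonexpansive_matrices. \<forall>x. norm (A *v x) = norm x \<longrightarrow> A *v x = x}"

lemma paracontracting_subset_nonexpansive: "paracontracting_matrices \<subseteq> nonexpansive_matrices"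
  by (auto simp: paracontracting_matrices_def)

lemma doubly_stochastic_norm_deficit:
  fixes A :: "real ^ 'n ^ 'n" and x :: "real ^ 'n"
  assumes "A \<in> doubly_stochastic"
  shows "(norm x)\<^sup>2 - (norm (A *v x))\<^sup>2 = (\<Sum>i\<in>UNIV. \<Sum>j\<in>UNIV. A $ i $ j * (x $ j - (A *v x) $ i)\<^sup>2)"
proof -
  define y where "y = A *v x"
  have row: "(\<Sum>j\<in>UNIV. A $ i $ j) = 1" and col: "(\<Sum>i\<in>UNIV. A $ i $ j) = 1" for i j
    using assms by (auto simp: doubly_stochastic_def)
  have y: "y $ i = (\<Sum>j\<in>UNIV. A $ i $ j * x $ j)" for i
    by (simp add: y_def matrix_vector_mult_def)
  have "(\<Sum>j\<in>UNIV. A $ i $ j * (x $ j - y $ i)\<^sup>2) = (\<Sum>j\<in>UNIV. A $ i $ j * (x $ j)\<^sup>2) - (y $ i)\<^sup>2"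
    for i
  proof -
    have "(\<Sum>j\<in>UNIV. A $ i $ j * (x $ j - y $ i)\<^sup>2)
      = (\<Sum>j\<in>UNIV. A $ i $ j * (x $ j)\<^sup>2 - 2 * y $ i * (A $ i $ j * x $ j) + (y $ i)\<^sup>2 * A $ i $ j)"
      by (rule sum.cong) (auto simp: power2_eq_square algebra_simps)
    also have "\<dots> = (\<Sum>j\<in>UNIV. A $ i $ j * (x $ j)\<^sup>2) - 2 * y $ i * y $ i + (y $ i)\<^sup>2 * 1"
      by (simp only: sum.distrib sum_subtractf row y sum_distrib_left[symmetric])
    finally show ?thesis by (simp add: power2_eq_square)
  qed
  then have "(\<Sum>i\<in>UNIV. \<Sum>j\<in>UNIV. A $ i $ j * (x $ j - y $ i)\<^sup>2)
    = (\<Sum>i\<in>UNIV. \<Sum>j\<in>UNIV. A $ i $ j * (x $ j)\<^sup>2) - (\<Sum>i\<in>UNIV. (y $ i)\<^sup>2)"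
    by (simp add: sum_subtractf)
  also have "(\<Sum>i\<in>UNIV. \<Sum>j\<in>UNIV. A $ i $ j * (x $ j)\<^sup>2) = (\<Sum>j\<in>UNIV. (x $ j)\<^sup>2)"
    by (subst sum.swap) (simp add: sum_distrib_right[symmetric] col)
  finally show ?thesis
    by (simp add: y_def power2_norm_eq_inner inner_vec_def) (simp add: power2_eq_square)
qed

lemma doubly_stochastic_nonexpansive:
  assumes "A \<in> doubly_stochastic"
  shows "A \<in> nonexpansive_matrices"
proof -
  have "0 \<le> (norm x)\<^sup>2 - (norm (A *v x))\<^sup>2" for x
    unfolding doubly_stochastic_norm_deficit[OF assms]
    using assms by (intro sum_nonneg mult_nonneg_nonneg) (auto simp: doubly_stochastic_def)
  then show ?thesis
    unfolding nonexpansive_matrices_def by (auto intro: power2_le_imp_le)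
qed

lemma doubly_stochastic_norm_eq_support:
  assumes "A \<in> doubly_stochastic" "norm (A *v x) = norm x" "A $ i $ j \<noteq> 0"
  shows "(A *v x) $ i = x $ j"
proof -
  have nonneg: "A $ i $ j \<ge> 0" for i j
    using assms(1) by (simp add: doubly_stochastic_def)
  have "(\<Sum>i\<in>UNIV. \<Sum>j\<in>UNIV. A $ i $ j * (x $ j - (A *v x) $ i)\<^sup>2) = 0"
    using doubly_stochastic_norm_deficit[OF assms(1), of x] assms(2) by simp
  then have "A $ i $ j * (x $ j - (A *v x) $ i)\<^sup>2 = 0"
    by (simp add: sum_nonneg_eq_0_iff sum_nonneg nonneg)
  then show ?thesis
    using assms(3) by simp
qed

lemma doubly_stochastic_block_sum:
  fixes A :: "real ^ 'n ^ 'n"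
  assumes "A \<in> doubly_stochastic" and block: "\<And>i j. A $ i $ j \<noteq> 0 \<Longrightarrow> i \<in> X \<longleftrightarrow> j \<in> Y"
  shows "(\<Sum>i\<in>X. \<Sum>j\<in>Y. A $ i $ j) = card X" and "card X = card Y"
proof -
  have row: "(\<Sum>j\<in>UNIV. A $ i $ j) = 1" and col: "(\<Sum>i\<in>UNIV. A $ i $ j) = 1" for i j
    using assms(1) by (auto simp: doubly_stochastic_def)
  have "(\<Sum>j\<in>Y. A $ i $ j) = 1" if "i \<in> X" for i
    unfolding row[of i, symmetric] using that block by (intro sum.mono_neutral_left) auto
  then show rows: "(\<Sum>i\<in>X. \<Sum>j\<in>Y. A $ i $ j) = card X"
    by simp
  have "(\<Sum>i\<in>X. A $ i $ j) = 1" if "j \<in> Y" for j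
    unfolding col[of j, symmetric] using that block by (intro sum.mono_neutral_left) auto
  then have "(\<Sum>i\<in>X. \<Sum>j\<in>Y. A $ i $ j) = card Y"
    by (subst sum.swap) simp
  with rows show "card X = card Y"
    by simp
qed

lemma domestic_block_eq:
  fixes A :: "real ^ 'n ^ 'n"
  assumes "0 < \<epsilon>" "A \<in> domestic_matrices \<epsilon>" and block: "\<And>i j. A $ i $ j \<noteq> 0 \<Longrightarrow> i \<in> X \<longleftrightarrow> j \<in> Y"
  shows "X = Y"
proof (rule ccontr)
  assume "X \<noteq> Y"
  have "A \<in> doubly_stochastic"
    using assms(2) by (simp add: domestic_matrices_def)
  note sum = doubly_stochastic_block_sum[OF this block]
  have "card X > 0"
    using \<open>X \<noteq> Y\<close> sum(2) by (metis card_0_eq finite gr0I)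
  then have "(\<Sum>i\<in>X. \<Sum>j\<in>Y. A $ i $ j) > (1 - \<epsilon>) * real (card X)"
    using sum(1) assms(1) by (simp add: algebra_simps)
  with \<open>X \<noteq> Y\<close> sum(2) assms(2) show False
    by (auto simp: domestic_matrices_def)
qed

lemma domestic_subset_paracontracting:
  assumes "0 < \<epsilon>"
  shows "domestic_matrices \<epsilon> \<subseteq> paracontracting_matrices"
proof
  fix A :: "real ^ 'n ^ 'n"
  assume A: "A \<in> domestic_matrices \<epsilon>"
  then have ds: "A \<in> doubly_stochastic"
    by (simp add: domestic_matrices_def)
  have "A *v x = x" if "norm (A *v x) = norm x" for x
  proof -
    have "{i. (A *v x) $ i = c} = {j. x $ j = c}" for c
      by (rule domestic_block_eq[OF assms A])
        (simp add: doubly_stochastic_norm_eq_support[OF ds that])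
    then show ?thesis
      by (auto simp: vec_eq_iff)
  qed
  with doubly_stochastic_nonexpansive[OF ds] show "A \<in> paracontracting_matrices"
    by (simp add: paracontracting_matrices_def)
qed

section \<open>Compact spaces of matrices\<close>

lemma continuous_on_matrix_mult [continuous_intros]:
  fixes f :: "'a::topological_space \<Rightarrow> real ^ 'n ^ 'm" and g :: "'a \<Rightarrow> real ^ 'k ^ 'n"
  assumes "continuous_on S f" "continuous_on S g"
  shows "continuous_on S (\<lambda>x. f x ** g x)"
  unfolding matrix_matrix_mult_def by (intro continuous_intros assms)

lemma continuous_on_matrix_vector_mult [continuous_intros]:
  fixes f :: "'a::topological_space \<Rightarrow> real ^ 'n ^ 'm" and g :: "'a \<Rightarrow> real ^ 'n"
  assumes "continuous_on S f" "continuous_on S g"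
  shows "continuous_on S (\<lambda>x. f x *v g x)"
  unfolding matrix_vector_mult_def by (intro continuous_intros assms)

lemma nonexpansive_matrix_mult:
  "A \<in> nonexpansive_matrices \<Longrightarrow> B \<in> nonexpansive_matrices \<Longrightarrow> A ** B \<in> nonexpansive_matrices"
  unfolding nonexpansive_matrices_def mem_Collect_eq
  by (metis matrix_vector_mul_assoc order_trans)

lemma compact_nonexpansive_matrices: "compact (nonexpansive_matrices :: (real ^ 'n ^ 'm) set)"
proof -
  have "\<bar>A \<bullet> b\<bar> \<le> 1" if A: "A \<in> nonexpansive_matrices" and "b \<in> Basis" for A b :: "real ^ 'n ^ 'm"
  proof -
    obtain i u where u: "u \<in> Basis" and b: "b = axis i u"
      using \<open>b \<in> Basis\<close> by (auto simp: Basis_vec_def)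
    have "\<bar>A \<bullet> b\<bar> = \<bar>(A *v u) $ i\<bar>"
      by (simp add: b inner_axis matrix_vector_mul_component)
    also have "\<dots> \<le> norm (A *v u)"
      by (rule component_le_norm_cart)
    also have "\<dots> \<le> norm u"
      using A by (simp add: nonexpansive_matrices_def)
    finally show ?thesis
      using u by simp
  qed
  then have "norm A \<le> (\<Sum>b\<in>(Basis :: (real ^ 'n ^ 'm) set). 1)"
    if "A \<in> nonexpansive_matrices" for A :: "real ^ 'n ^ 'm"
    using that by (intro order_trans[OF norm_le_l1] sum_mono) auto
  then have "bounded (nonexpansive_matrices :: (real ^ 'n ^ 'm) set)"
    by (rule boundedI)
  moreover have "closed (nonexpansive_matrices :: (real ^ 'n ^ 'm) set)"
    unfolding nonexpansive_matrices_def
    by (intro closed_Collect_all closed_Collect_le continuous_intros)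
  ultimately show ?thesis
    by (simp add: compact_eq_bounded_closed)
qed

lemma compact_strict_contractions_uniform:
  fixes K :: "(real ^ 'n ^ 'm) set"
  assumes "compact K" "subspace V"
    and strict: "\<And>A y. A \<in> K \<Longrightarrow> y \<in> V \<Longrightarrow> y \<noteq> 0 \<Longrightarrow> norm (A *v y) < norm y"
  obtains q where "0 \<le> q" "q < 1" "\<And>A y. A \<in> K \<Longrightarrow> y \<in> V \<Longrightarrow> norm (A *v y) \<le> q * norm y"
proof -
  define R where "R = (\<lambda>(A, y). norm (A *v y)) ` (K \<times> (sphere 0 1 \<inter> V))"
  have "compact (K \<times> (sphere 0 1 \<inter> V))"
    using assms(1,2) by (intro compact_Times compact_Int_closed compact_sphere closed_subspace)
  then have "compact (insert 0 R)"
    unfolding R_def case_prod_unfold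
    by (intro compact_insert compact_continuous_image continuous_intros)
  then obtain q where q: "q \<in> insert 0 R" "\<And>r. r \<in> insert 0 R \<Longrightarrow> r \<le> q"
    using compact_attains_sup[of "insert 0 R"] by blast
  have "r < 1" if "r \<in> R" for r
    using that strict by (force simp: R_def)
  then have "q < 1"
    using q(1) by auto
  moreover have "norm (A *v y) \<le> q * norm y" if "A \<in> K" "y \<in> V" for A y
  proof (cases "y = 0")
    case False
    then have "y /\<^sub>R norm y \<in> sphere 0 1 \<inter> V"
      using that(2) assms(2) by (simp add: subspace_scale)
    then have "norm (A *v (y /\<^sub>R norm y)) \<in> R"
      using that(1) by (force simp: R_def)
    then have "norm (A *v (y /\<^sub>R norm y)) \<le> q"
      using q(2) by blast
    then show ?thesis
      using False by (simp add: matrix_vector_mult_scaleR field_simps)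
  qed simp
  ultimately show thesis
    using q(2) by (intro that) auto
qed

section \<open>Closures of matrix semigroups\<close>

definition matrix_product :: "(real ^ 'n ^ 'n) list \<Rightarrow> real ^ 'n ^ 'n" where
  "matrix_product w = foldr (**) w (mat 1)"

lemma matrix_product_simps [simp]:
  "matrix_product [] = mat 1"
  "matrix_product (a # w) = a ** matrix_product w"
  by (simp_all add: matrix_product_def)

lemma matrix_product_append: "matrix_product (v @ w) = matrix_product v ** matrix_product w"
  by (induction v) (simp_all add: matrix_mul_assoc)

lemma generated_semigroup_least:
  assumes "N \<subseteq> S" "mat 1 \<in> S" "\<And>A B. A \<in> S \<Longrightarrow> B \<in> S \<Longrightarrow> A ** B \<in> S"
  shows "generated_semigroup N \<subseteq> S"
proof
  fix A assume "A \<in> generated_semigroup N"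
  then show "A \<in> S" by induction (use assms in auto)
qed

lemma generated_semigroup_mono: "N \<subseteq> N' \<Longrightarrow> generated_semigroup N \<subseteq> generated_semigroup N'"
  by (intro generated_semigroup_least) (auto intro: generated_semigroup.intros)

lemma generated_semigroup_eq_matrix_product: "generated_semigroup N = matrix_product ` lists N"
proof
  show "generated_semigroup N \<subseteq> matrix_product ` lists N"
  proof (rule generated_semigroup_least)
    show "N \<subseteq> matrix_product ` lists N"
    proof
      fix A assume "A \<in> N"
      then show "A \<in> matrix_product ` lists N"
        by (intro image_eqI[of _ _ "[A]"]) auto
    qed
    show "mat 1 \<in> matrix_product ` lists N"
      by (intro image_eqI[of _ _ "[]"]) auto
    show "A ** B \<in> matrix_product ` lists N"
      if "A \<in> matrix_product ` lists N" "B \<in> matrix_product ` lists N" for A B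
    proof -
      from that obtain v w where "v \<in> lists N" "w \<in> lists N"
        and "A = matrix_product v" "B = matrix_product w"
        by blast
      then show ?thesis
        by (intro image_eqI[of _ _ "v @ w"]) (auto simp: matrix_product_append)
    qed
  qed
  have "matrix_product w \<in> generated_semigroup N" if "w \<in> lists N" for w
    using that by induction (auto intro: generated_semigroup.intros)
  then show "matrix_product ` lists N \<subseteq> generated_semigroup N"
    by blast
qed

lemma countable_generated_semigroup: "countable N \<Longrightarrow> countable (generated_semigroup N)"
  by (simp add: generated_semigroup_eq_matrix_product countable_lists)

lemma mat_1_in_closure_generated_semigroup: "mat 1 \<in> closure (generated_semigroup N)"
  by (simp add: closure_subset[THEN subsetD] generated_semigroup.identity)

lemma closure_generated_semigroup_mult:
  assumes "A \<in> closure (generated_semigroup N)" "B \<in> closure (generated_semigroup N)"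
  shows "A ** B \<in> closure (generated_semigroup N)"
proof -
  let ?S = "generated_semigroup N"
  have "(\<lambda>(A, B). A ** B) ` closure (?S \<times> ?S) \<subseteq> closure ?S"
    by (rule image_closure_subset)
      (auto simp: case_prod_unfold intro!: continuous_intros
        generated_semigroup.product closure_subset[THEN subsetD])
  then show ?thesis
    using assms by (auto simp: closure_Times)
qed

lemma closure_generated_semigroup_nonexpansive:
  assumes "N \<subseteq> nonexpansive_matrices"
  shows "closure (generated_semigroup N) \<subseteq> nonexpansive_matrices"
  using assms nonexpansive_matrix_mult
  by (intro closure_minimal generated_semigroup_least compact_imp_closed
      compact_nonexpansive_matrices) (auto simp: nonexpansive_matrices_def)

lemma compact_closure_nonexpansive:
  assumes "S \<subseteq> nonexpansive_matrices"
  shows "compact (closure S)"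
  using compact_nonexpansive_matrices assms
  by (meson bounded_subset compact_closure compact_imp_bounded)

lemma compact_closure_generated_semigroup:
  assumes "N \<subseteq> nonexpansive_matrices"
  shows "compact (closure (generated_semigroup N))"
  using closure_generated_semigroup_nonexpansive[OF assms] closure_subset
  by (intro compact_closure_nonexpansive) blast

definition fixed_space :: "(real ^ 'n ^ 'n) set \<Rightarrow> (real ^ 'n) set" where
  "fixed_space N = {x. \<forall>A\<in>N. A *v x = x}"

lemma subspace_fixed_space: "subspace (fixed_space N)"
  by (auto simp: subspace_def fixed_space_def matrix_vector_right_distrib matrix_vector_mult_scaleR)

lemma closure_generated_semigroup_fixed:
  assumes "B \<in> closure (generated_semigroup N)" "x \<in> fixed_space N"
  shows "B *v x = x"
proof -
  have "closure (generated_semigroup N) \<subseteq> {B. B *v x = x}"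
    using assms(2)
    by (intro closure_minimal generated_semigroup_least closed_Collect_eq continuous_intros)
      (auto simp: fixed_space_def matrix_vector_mul_assoc[symmetric])
  then show ?thesis using assms(1) by auto
qed

lemma nonexpansive_fixed_imp_transpose_fixed:
  assumes "A \<in> nonexpansive_matrices" and fixed: "A *v x = x"
  shows "x v* A = x"
proof -
  define u where "u = x v* A"
  have u: "u \<bullet> z = x \<bullet> (A *v z)" for z
    by (simp add: u_def dot_lmul_matrix)
  have "norm u * norm u = x \<bullet> (A *v u)"
    by (simp add: u[symmetric] norm_eq_sqrt_inner)
  also have "\<dots> \<le> norm x * norm (A *v u)"
    by (rule norm_cauchy_schwarz)
  also have "\<dots> \<le> norm x * norm u"
    using assms(1) by (simp add: nonexpansive_matrices_def mult_left_mono)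
  finally have "norm u \<le> norm x"
    by (metis mult_le_cancel_right norm_ge_zero norm_le_zero_iff order_le_less not_le)
  then have "u \<bullet> u \<le> x \<bullet> x"
    by (simp add: norm_le)
  then have "(norm (u - x))\<^sup>2 \<le> 0"
    by (simp add: power2_norm_eq_inner inner_diff inner_commute[of x u] u[of x] fixed)
  then show ?thesis
    by (simp add: u_def)
qed

lemma closure_generated_semigroup_orthogonal_comp_invariant:
  assumes "N \<subseteq> nonexpansive_matrices" "B \<in> closure (generated_semigroup N)" "y \<in> (fixed_space N)\<^sup>\<bottom>"
  shows "B *v y \<in> (fixed_space N)\<^sup>\<bottom>"
proof -
  have "x \<bullet> (B *v y) = 0" if "x \<in> fixed_space N" for x
  proof -
    have "x v* B = x"
      using assms(2) closure_generated_semigroup_nonexpansive[OF assms(1)]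
        closure_generated_semigroup_fixed[OF assms(2) that]
      by (intro nonexpansive_fixed_imp_transpose_fixed) auto
    then have "x \<bullet> (B *v y) = x \<bullet> y"
      by (metis dot_lmul_matrix)
    then show ?thesis
      using assms(3) that by (simp add: orthogonal_comp_def orthogonal_def)
  qed
  then show ?thesis
    by (simp add: orthogonal_comp_def orthogonal_def)
qed

lemma closure_generated_semigroup_eq_if_annihilates:
  assumes "A \<in> closure (generated_semigroup N)" "B \<in> closure (generated_semigroup N)"
    and "\<And>y. y \<in> (fixed_space N)\<^sup>\<bottom> \<Longrightarrow> A *v y = 0" "\<And>y. y \<in> (fixed_space N)\<^sup>\<bottom> \<Longrightarrow> B *v y = 0"
  shows "A = B"
proof (rule matrix_eq[THEN iffD2], rule allI)
  fix x
  obtain u y where "x = u + y" "u \<in> fixed_space N" "y \<in> (fixed_space N)\<^sup>\<bottom>"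
    using subspace_sum_orthogonal_comp[OF subspace_fixed_space] by (metis UNIV_I set_plus_elim)
  then show "A *v x = B *v x"
    using assms by (simp add: matrix_vector_right_distrib closure_generated_semigroup_fixed)
qed

lemma finite_closure_annihilates_orthogonal_comp:
  "finite {A \<in> closure (generated_semigroup N). \<forall>y\<in>(fixed_space N)\<^sup>\<bottom>. A *v y = 0}" (is "finite ?L")
proof -
  have "?L \<subseteq> {A}" if "A \<in> ?L" for A
    using that closure_generated_semigroup_eq_if_annihilates[of _ N A] by auto
  then obtain A where "?L \<subseteq> {A}"
    by blast
  then show ?thesis
    by (rule finite_subset) simp
qed

section \<open>Limits of products that use every generator\<close>

definition full_products :: "(real ^ 'n ^ 'n) set \<Rightarrow> (real ^ 'n ^ 'n) set" where
  "full_products N = matrix_product ` {w. set w = N}"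

lemma generated_semigroup_eq_Union_full_products:
  "generated_semigroup N = \<Union> (full_products ` Pow N)"
  by (auto simp: generated_semigroup_eq_matrix_product full_products_def)

lemma full_products_subset: "full_products N \<subseteq> generated_semigroup N"
  by (auto simp: generated_semigroup_eq_Union_full_products)

lemma closure_generated_semigroup_cases:
  assumes "finite N" "A \<in> closure (generated_semigroup N)"
  obtains K where "K \<subset> N" "A \<in> closure (generated_semigroup K)" | "A \<in> closure (full_products N)"
proof -
  have "closure (generated_semigroup N) \<subseteq> (\<Union>K\<in>Pow N. closure (full_products K))"
    unfolding generated_semigroup_eq_Union_full_products using assms(1) closure_subset
    by (intro closure_minimal closed_UN) blast+
  then obtain K where "K \<subseteq> N" "A \<in> closure (full_products K)"
    using assms(2) by blast
  then show thesis
    using that closure_mono[OF full_products_subset[of K]] by blast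
qed

lemma split_list_shortest_full_suffix:
  assumes "w \<noteq> []"
  shows "\<exists>v a c. w = v @ a # c \<and> set c = set w - {a}"
  using assms
proof (induction w)
  case (Cons x w)
  show ?case
  proof (cases "x \<in> set w")
    case True
    then obtain v a c where "w = v @ a # c" and c: "set c = set w - {a}"
      using Cons.IH by (metis empty_iff list.set(1))
    then have "x # w = (x # v) @ a # c"
      by simp
    moreover have "set c = set (x # w) - {a}"
      using c True by (simp add: insert_absorb)
    ultimately show ?thesis
      by blast
  next
    case False
    then have "x # w = [] @ x # w \<and> set w = set (x # w) - {x}"
      by simp
    then show ?thesis
      by blast
  qed
qed simp

lemma closure_full_products_decomp:
  assumes "finite N" "N \<noteq> {}" "N \<subseteq> nonexpansive_matrices" "A \<in> closure (full_products N)"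
  obtains a B C where "a \<in> N" "B \<in> closure (generated_semigroup N)"
    "C \<in> closure (full_products (N - {a}))" "A = B ** (a ** C)"
proof -
  define D where "D a = (\<lambda>(B, C). B ** (a ** C)) `
    (closure (generated_semigroup N) \<times> closure (full_products (N - {a})))" for a
  have "full_products (N - {a}) \<subseteq> nonexpansive_matrices" for a
    using closure_generated_semigroup_nonexpansive[OF assms(3)] full_products_subset[of "N - {a}"]
      generated_semigroup_mono[of "N - {a}" N] closure_subset[of "generated_semigroup N"] by blast
  then have "compact (D a)" for a
    unfolding D_def case_prod_unfold
    using compact_closure_generated_semigroup[OF assms(3)] compact_closure_nonexpansive
    by (intro compact_continuous_image compact_Times continuous_intros) blast+
  then have "closed (\<Union>a\<in>N. D a)"
    using assms(1) by (intro compact_imp_closed compact_UN) auto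
  moreover have "full_products N \<subseteq> (\<Union>a\<in>N. D a)"
  proof
    fix A assume "A \<in> full_products N"
    then obtain w where w: "set w = N" "A = matrix_product w"
      by (auto simp: full_products_def)
    with assms(2) obtain v a c where vac: "w = v @ a # c" "set c = N - {a}"
      using split_list_shortest_full_suffix[of w] by auto
    then have "matrix_product v \<in> generated_semigroup N"
      and "matrix_product c \<in> full_products (N - {a})"
      using w(1) by (auto simp: generated_semigroup_eq_matrix_product full_products_def)
    then have "A \<in> D a"
      using w(2) vac(1) closure_subset by (force simp: D_def matrix_product_append)
    then show "A \<in> (\<Union>a\<in>N. D a)"
      using w(1) vac(1) by auto
  qed
  ultimately have "closure (full_products N) \<subseteq> (\<Union>a\<in>N. D a)"
    by (rule closure_minimal[rotated])
  then show thesis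
    using assms(4) that by (auto simp: D_def)
qed

lemma closure_full_products_Cons:
  assumes "a \<in> N" "C \<in> closure (full_products (N - {a}))"
  shows "a ** C \<in> closure (full_products N)"
proof -
  have "a ** C \<in> full_products N" if C: "C \<in> full_products (N - {a})" for C
  proof -
    obtain w where "set w = N - {a}" "C = matrix_product w"
      using C by (auto simp: full_products_def)
    then show ?thesis
      unfolding full_products_def using assms(1) by (intro image_eqI[of _ _ "a # w"]) auto
  qed
  then have "(**) a ` closure (full_products (N - {a})) \<subseteq> closure (full_products N)"
    using closure_subset by (intro image_closure_subset continuous_intros) blast+
  then show ?thesis
    using assms(2) by blast
qed

lemma closure_full_products_norm_eq_imp_fixed:
  assumes "finite N" "N \<subseteq> paracontracting_matrices"
    and "A \<in> closure (full_products N)" "norm (A *v y) = norm y"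
  shows "y \<in> fixed_space N"
  using assms
proof (induction N arbitrary: A rule: finite_psubset_induct)
  case (psubset N)
  have nonexp: "N \<subseteq> nonexpansive_matrices"
    using psubset.prems(1) paracontracting_subset_nonexpansive by blast
  show ?case
  proof (cases "N = {}")
    case True
    then show ?thesis by (simp add: fixed_space_def)
  next
    case False
    obtain a B C where a: "a \<in> N" and B: "B \<in> closure (generated_semigroup N)"
      and C: "C \<in> closure (full_products (N - {a}))" and A: "A = B ** (a ** C)"
      using closure_full_products_decomp[OF psubset.hyps(1) False nonexp psubset.prems(2)] .
    have C_generated: "C \<in> closure (generated_semigroup (N - {a}))"
      using C closure_mono[OF full_products_subset] by blast
    have "B \<in> nonexpansive_matrices" "a \<in> nonexpansive_matrices" "C \<in> nonexpansive_matrices"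
      using a B C_generated nonexp closure_generated_semigroup_nonexpansive[of N]
        closure_generated_semigroup_nonexpansive[of "N - {a}"] by blast+
    then have "norm (A *v y) \<le> norm (a *v (C *v y))" "norm (a *v (C *v y)) \<le> norm (C *v y)"
      "norm (C *v y) \<le> norm y"
      by (simp_all add: A nonexpansive_matrices_def matrix_vector_mul_assoc[symmetric])
    with psubset.prems(3) have norms: "norm (C *v y) = norm y" "norm (a *v (C *v y)) = norm y"
      by simp_all
    have y: "y \<in> fixed_space (N - {a})"
      using a psubset.prems(1) by (intro psubset.IH[OF _ _ C norms(1)]) auto
    then have "C *v y = y"
      by (rule closure_generated_semigroup_fixed[OF C_generated])
    with norms(2) have "a *v y = y"
      using a psubset.prems(1) by (auto simp: paracontracting_matrices_def)
    with y show ?thesis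
      by (auto simp: fixed_space_def)
  qed
qed

lemma closure_full_products_uniform_contraction:
  assumes "finite N" and para: "N \<subseteq> paracontracting_matrices"
  obtains q where "0 \<le> q" "q < 1"
    "\<And>A y. A \<in> closure (full_products N) \<Longrightarrow> y \<in> (fixed_space N)\<^sup>\<bottom> \<Longrightarrow> norm (A *v y) \<le> q * norm y"
proof -
  have "N \<subseteq> nonexpansive_matrices"
    using para paracontracting_subset_nonexpansive by blast
  then have full_nonexpansive: "closure (full_products N) \<subseteq> nonexpansive_matrices"
    using closure_generated_semigroup_nonexpansive closure_mono[OF full_products_subset] by blast
  have strict: "norm (A *v y) < norm y"
    if "A \<in> closure (full_products N)" "y \<in> (fixed_space N)\<^sup>\<bottom>" "y \<noteq> 0" for A y
  proof -
    have "y \<notin> fixed_space N"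
      using that(2,3) by (auto simp: orthogonal_comp_def orthogonal_self)
    then have "norm (A *v y) \<noteq> norm y"
      using closure_full_products_norm_eq_imp_fixed[OF assms that(1)] by blast
    moreover have "norm (A *v y) \<le> norm y"
      using that(1) full_nonexpansive by (auto simp: nonexpansive_matrices_def)
    ultimately show ?thesis by simp
  qed
  have "compact (closure (full_products N))"
    using full_nonexpansive closure_subset by (intro compact_closure_nonexpansive) blast
  then show thesis
    by (rule compact_strict_contractions_uniform[OF _ subspace_orthogonal_comp])
      (fact strict, fact that)
qed

lemma closure_generated_semigroup_strip_full_block:
  assumes "finite N" and nonexp: "N \<subseteq> nonexpansive_matrices"
    and letters: "N \<subseteq> generated_semigroup F"
    and smaller: "\<And>K. K \<subset> N \<Longrightarrow> closure (generated_semigroup K) \<subseteq> generated_semigroup F"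
    and A: "A \<in> closure (generated_semigroup N)" "A \<notin> generated_semigroup F"
  obtains B D where "B \<in> closure (generated_semigroup N)" "B \<notin> generated_semigroup F"
    "D \<in> closure (full_products N)" "A = B ** D"
proof -
  have full: "A \<in> closure (full_products N)"
    using assms(1) A(1)
    by (cases rule: closure_generated_semigroup_cases) (use smaller A(2) in blast)+
  have "N \<noteq> {}"
    using full A(2) generated_semigroup.identity[of F] by (auto simp: full_products_def)
  then obtain a B C where a: "a \<in> N" and B: "B \<in> closure (generated_semigroup N)"
    and C: "C \<in> closure (full_products (N - {a}))" and A_eq: "A = B ** (a ** C)"
    using closure_full_products_decomp[OF assms(1) _ nonexp full] by blast
  have "C \<in> generated_semigroup F"
    using C closure_mono[OF full_products_subset] smaller[of "N - {a}"] a by blast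
  then have "a ** C \<in> generated_semigroup F"
    using a letters by (blast intro: generated_semigroup.product)
  then have "B \<notin> generated_semigroup F"
    using A(2) A_eq by (blast intro: generated_semigroup.product)
  then show thesis
    using B closure_full_products_Cons[OF a C] A_eq by (intro that)
qed

lemma closure_generated_semigroup_annihilates_if_not_generated:
  assumes "finite N" and para: "N \<subseteq> paracontracting_matrices"
    and letters: "N \<subseteq> generated_semigroup F"
    and smaller: "\<And>K. K \<subset> N \<Longrightarrow> closure (generated_semigroup K) \<subseteq> generated_semigroup F"
    and "A \<in> closure (generated_semigroup N)" "A \<notin> generated_semigroup F"
    and "y \<in> (fixed_space N)\<^sup>\<bottom>"
  shows "A *v y = 0"
proof -
  have nonexp: "N \<subseteq> nonexpansive_matrices"
    using para paracontracting_subset_nonexpansive by blast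
  obtain q where q: "0 \<le> q" "q < 1" "\<And>A y. A \<in> closure (full_products N) \<Longrightarrow>
      y \<in> (fixed_space N)\<^sup>\<bottom> \<Longrightarrow> norm (A *v y) \<le> q * norm y"
    using closure_full_products_uniform_contraction[OF assms(1) para] by blast
  have "norm (A *v y) \<le> q ^ m * norm y" for m
    using assms(5-7)
  proof (induction m arbitrary: A y)
    case 0
    then have "A \<in> nonexpansive_matrices"
      using closure_generated_semigroup_nonexpansive[OF nonexp] by blast
    then show ?case
      by (simp add: nonexpansive_matrices_def)
  next
    case (Suc m)
    obtain B D where B: "B \<in> closure (generated_semigroup N)" "B \<notin> generated_semigroup F"
      and D: "D \<in> closure (full_products N)" and A_eq: "A = B ** D"
      using assms(1) nonexp letters smaller Suc.prems(1,2)
      by (rule closure_generated_semigroup_strip_full_block)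
    have invariant: "D *v y \<in> (fixed_space N)\<^sup>\<bottom>"
      using D closure_mono[OF full_products_subset]
        closure_generated_semigroup_orthogonal_comp_invariant[OF nonexp _ Suc.prems(3)] by blast
    have "norm (A *v y) \<le> q ^ m * norm (D *v y)"
      using Suc.IH[OF B invariant] by (simp add: A_eq matrix_vector_mul_assoc)
    also have "\<dots> \<le> q ^ m * (q * norm y)"
      using q(3)[OF D Suc.prems(3)] q(1) by (simp add: mult_left_mono)
    finally show ?case
      by (simp add: mult.assoc mult.left_commute)
  qed
  moreover have "(\<lambda>m. q ^ m * norm y) \<longlonglongrightarrow> 0"
    using q(1,2) by (intro tendsto_mult_left_zero LIMSEQ_power_zero) auto
  ultimately have "norm (A *v y) \<le> 0"
    by (intro LIMSEQ_le_const) auto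
  then show ?thesis by simp
qed

theorem finitely_generated_closure_paracontracting:
  assumes "finite N" "N \<subseteq> paracontracting_matrices"
  shows "finitely_generated (closure (generated_semigroup N))"
  using assms
proof (induction N rule: finite_psubset_induct)
  case (psubset N)
  let ?S = "closure (generated_semigroup N)"
  have "\<exists>F. finite F \<and> closure (generated_semigroup K) = generated_semigroup F" if "K \<subset> N" for K
    using psubset.IH[OF that] that psubset.prems by (auto simp: finitely_generated_def)
  then obtain F where F: "\<And>K. K \<subset> N \<Longrightarrow> finite (F K)"
    "\<And>K. K \<subset> N \<Longrightarrow> closure (generated_semigroup K) = generated_semigroup (F K)"
    by metis
  define L where "L = {A \<in> ?S. \<forall>y\<in>(fixed_space N)\<^sup>\<bottom>. A *v y = 0}"
  define G where "G = N \<union> (\<Union>K\<in>{K. K \<subset> N}. F K) \<union> L"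
  have "finite {K. K \<subset> N}"
    using psubset.hyps by (auto intro: finite_subset[of _ "Pow N"])
  then have "finite G"
    unfolding G_def L_def using psubset.hyps F(1)
      finite_closure_annihilates_orthogonal_comp by blast
  moreover have "?S = generated_semigroup G"
  proof
    have "N \<subseteq> generated_semigroup G"
      by (auto simp: G_def intro: generated_semigroup.generator)
    moreover have "closure (generated_semigroup K) \<subseteq> generated_semigroup G" if "K \<subset> N" for K
      unfolding F(2)[OF that] using that by (intro generated_semigroup_mono) (auto simp: G_def)
    moreover have "L \<subseteq> generated_semigroup G"
      by (auto simp: G_def intro: generated_semigroup.generator)
    ultimately show "?S \<subseteq> generated_semigroup G"
      using closure_generated_semigroup_annihilates_if_not_generated[OF psubset.hyps psubset.prems]
      unfolding L_def by blast
    have "F K \<subseteq> ?S" if "K \<subset> N" for K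
      using F(2)[OF that] closure_mono[OF generated_semigroup_mono[of K N]] that
      by (blast intro: generated_semigroup.generator)
    then have "G \<subseteq> ?S"
      using closure_subset[of "generated_semigroup N"]
      by (auto simp: G_def L_def intro: generated_semigroup.generator)
    then show "generated_semigroup G \<subseteq> ?S"
      by (rule generated_semigroup_least)
        (auto intro: mat_1_in_closure_generated_semigroup closure_generated_semigroup_mult)
  qed
  ultimately show ?case
    unfolding finitely_generated_def by blast
qed

section \<open>Compact spaces over an inverse system of finite semigroups\<close>

context finite_semigroup_inverse_system
begin

lemma finite_upper_bound:
  assumes "finite J" "J \<subseteq> I"
  shows "\<exists>k\<in>I. \<forall>j\<in>J. le j k"
  using assms
proof (induction J rule: finite_induct)
  case empty
  then show ?case using nonempty by blast
next
  case (insert i J)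
  then obtain k where k: "k \<in> I" "\<forall>j\<in>J. le j k" by blast
  then obtain k' where k': "k' \<in> I" "le i k'" "le k k'"
    using directed[of i k] insert.prems by blast
  then have "le j k'" if "j \<in> J" for j
    using le_trans[of j k k'] k that insert.prems by blast
  with k' show ?case by blast
qed

lemma semigroup_hom_on_projective_limit:
  assumes "\<And>i. i \<in> I \<Longrightarrow> semigroup_hom_on S f (T i) (g i) (q i)"
    and "\<And>i j x. i \<in> I \<Longrightarrow> j \<in> I \<Longrightarrow> le i j \<Longrightarrow> x \<in> S \<Longrightarrow> p i j (q j x) = q i x"
  shows "semigroup_hom_on S f (projective_limit I le T p) (projective_limit_mult I g)
    (\<lambda>x. \<lambda>i\<in>I. q i x)"
  using assms
  by (auto simp: semigroup_hom_on_def projective_limit_def projective_limit_mult_def Pi_iff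
      intro!: restrict_ext)

lemma compact_space_onto_projective_limit:
  assumes "compact_space X"
    and cont: "\<And>i. i \<in> I \<Longrightarrow> continuous_map X (discrete_topology (T i)) (q i)"
    and onto: "\<And>i. i \<in> I \<Longrightarrow> q i ` topspace X = T i"
    and compat: "\<And>i j x. i \<in> I \<Longrightarrow> j \<in> I \<Longrightarrow> le i j \<Longrightarrow> x \<in> topspace X \<Longrightarrow> p i j (q j x) = q i x"
  shows "(\<lambda>x. \<lambda>i\<in>I. q i x) ` topspace X = projective_limit I le T p"
proof (intro equalityI subsetI)
  fix z assume "z \<in> (\<lambda>x. \<lambda>i\<in>I. q i x) ` topspace X"
  then show "z \<in> projective_limit I le T p"
    using onto compat by (force simp: projective_limit_def)
next
  fix z assume "z \<in> projective_limit I le T p"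
  then have z: "z \<in> PiE I T" and z_compat: "\<And>i j. i \<in> I \<Longrightarrow> j \<in> I \<Longrightarrow> le i j \<Longrightarrow> p i j (z j) = z i"
    by (auto simp: projective_limit_def)
  define fibre where "fibre i = {x \<in> topspace X. q i x = z i}" for i
  have "closedin X (fibre i)" if "i \<in> I" for i
    using closedin_continuous_map_preimage[OF cont[OF that], of "{z i}"] z that
    by (auto simp: fibre_def PiE_iff)
  moreover have "(\<Inter>i\<in>J. fibre i) \<noteq> {}" if J: "finite J" "J \<subseteq> I" for J
  proof -
    obtain k where k: "k \<in> I" "\<And>j. j \<in> J \<Longrightarrow> le j k"
      using finite_upper_bound[OF J] by blast
    then obtain x where x: "x \<in> topspace X" "q k x = z k"
      using onto[of k] z by (metis PiE_mem imageE)
    have "x \<in> fibre j" if "j \<in> J" for j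
      using that J(2) k x compat[of j k x] z_compat[of j k] by (auto simp: fibre_def)
    then show ?thesis by blast
  qed
  then have "\<Inter>\<F> \<noteq> {}" if "finite \<F>" "\<F> \<subseteq> fibre ` I" for \<F>
    using that by (metis finite_subset_image)
  ultimately have "(\<Inter>i\<in>I. fibre i) \<noteq> {}"
    using assms(1) unfolding compact_space_fip by (metis (no_types, lifting) imageE)
  then obtain x where x: "\<And>i. i \<in> I \<Longrightarrow> x \<in> fibre i" by blast
  then have "x \<in> topspace X"
    using nonempty by (auto simp: fibre_def)
  moreover have "(\<lambda>i\<in>I. q i x) = z"
    using x z by (intro extensionalityI[of _ I]) (auto simp: fibre_def PiE_def)
  ultimately show "z \<in> (\<lambda>x. \<lambda>i\<in>I. q i x) ` topspace X" by blast
qed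

lemma homeomorphic_map_projective_limit:
  assumes "compact_space X"
    and cont: "\<And>i. i \<in> I \<Longrightarrow> continuous_map X (discrete_topology (T i)) (q i)"
    and onto: "\<And>i. i \<in> I \<Longrightarrow> q i ` topspace X = T i"
    and compat: "\<And>i j x. i \<in> I \<Longrightarrow> j \<in> I \<Longrightarrow> le i j \<Longrightarrow> x \<in> topspace X \<Longrightarrow> p i j (q j x) = q i x"
    and separating: "\<And>x y. x \<in> topspace X \<Longrightarrow> y \<in> topspace X \<Longrightarrow> x \<noteq> y \<Longrightarrow> \<exists>i\<in>I. q i x \<noteq> q i y"
  shows "homeomorphic_map X (projective_limit_topology I le T p) (\<lambda>x. \<lambda>i\<in>I. q i x)"
proof (rule continuous_imp_homeomorphic_map)
  have topspace_limit: "topspace (projective_limit_topology I le T p) = projective_limit I le T p"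
    by (auto simp: projective_limit_topology_def projective_limit_def)
  have image: "(\<lambda>x. \<lambda>i\<in>I. q i x) ` topspace X = projective_limit I le T p"
    using assms(1) cont onto compat by (rule compact_space_onto_projective_limit)
  have "continuous_map X (product_topology (\<lambda>i. discrete_topology (T i)) I) (\<lambda>x. \<lambda>i\<in>I. q i x)"
    using cont by (auto simp: continuous_map_componentwise)
  then show "continuous_map X (projective_limit_topology I le T p) (\<lambda>x. \<lambda>i\<in>I. q i x)"
    unfolding projective_limit_topology_def using image
    by (auto simp: continuous_map_in_subtopology)
  show "(\<lambda>x. \<lambda>i\<in>I. q i x) ` topspace X = topspace (projective_limit_topology I le T p)"
    by (simp add: image topspace_limit)
  show "Hausdorff_space (projective_limit_topology I le T p)"
    unfolding projective_limit_topology_def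
    by (intro Hausdorff_space_subtopology) (simp add: Hausdorff_space_product_topology)
  show "inj_on (\<lambda>x. \<lambda>i\<in>I. q i x) (topspace X)"
    using separating by (intro inj_onI) (metis restrict_apply')
qed (fact assms(1))

end

section \<open>Open equivalence relations and congruences\<close>

lemma openin_equiv_class:
  assumes "openin (prod_topology X X) R" "x \<in> topspace X"
  shows "openin X (R `` {x})"
proof -
  have "openin X {y \<in> topspace X. (x, y) \<in> R}"
    using assms(2) by (intro openin_continuous_map_preimage[OF _ assms(1)] continuous_intros) simp
  moreover have "R `` {x} = {y \<in> topspace X. (x, y) \<in> R}"
    using openin_subset[OF assms(1)] by auto
  ultimately show ?thesis by simp
qed

lemma finite_quotient_if_openin:
  assumes "compact_space X" and eq: "equiv (topspace X) R" and "openin (prod_topology X X) R"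
  shows "finite (topspace X // R)"
proof -
  have "\<forall>U\<in>topspace X // R. openin X U"
    using openin_equiv_class[OF assms(3)] by (auto elim!: quotientE)
  then obtain \<F> where \<F>: "finite \<F>" "\<F> \<subseteq> topspace X // R" "\<Union>\<F> = topspace X"
    using assms(1) Union_quotient[OF eq] unfolding compact_space by meson
  have "C \<in> \<F>" if C: "C \<in> topspace X // R" for C
  proof -
    obtain x where x: "x \<in> C" "x \<in> topspace X"
      using in_quotient_imp_non_empty[OF eq C] in_quotient_imp_subset[OF eq C] by blast
    then obtain D where D: "D \<in> \<F>" "x \<in> D"
      using \<F>(3) by blast
    then have "C = D"
      using quotient_disj[OF eq C, of D] \<F>(2) x(1) by blast
    with D show ?thesis by simp
  qed
  with \<F>(1) show ?thesis
    by (meson finite_subset subsetI)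
qed

lemma openin_Collect_ball_compact_space:
  assumes "compact_space K" "openin (prod_topology K X) W"
  shows "openin X {x \<in> topspace X. \<forall>k\<in>topspace K. (k, x) \<in> W}"
proof -
  have "closedin (prod_topology K X) (topspace (prod_topology K X) - W)"
    using assms(2) by blast
  then have "closedin X (snd ` (topspace (prod_topology K X) - W))"
    using Abstract_Topological_Spaces.closed_map_snd[OF assms(1)] unfolding closed_map_def by blast
  moreover have "{x \<in> topspace X. \<forall>k\<in>topspace K. (k, x) \<in> W}
    = topspace X - snd ` (topspace (prod_topology K X) - W)"
    by force
  ultimately show ?thesis
    by (metis openin_diff openin_topspace)
qed

definition action_core :: "'k set \<Rightarrow> ('k \<Rightarrow> 'a \<Rightarrow> 'a) \<Rightarrow> ('a \<times> 'a) set \<Rightarrow> ('a \<times> 'a) set" where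
  "action_core K \<phi> R = {(x, y) \<in> R. \<forall>k\<in>K. (\<phi> k x, \<phi> k y) \<in> R}"

lemma equiv_action_core:
  assumes "equiv S R" "\<And>k x. k \<in> K \<Longrightarrow> x \<in> S \<Longrightarrow> \<phi> k x \<in> S"
  shows "equiv S (action_core K \<phi> R)"
proof (rule equivI)
  have R: "R \<subseteq> S \<times> S" "refl_on S R" "sym R" "trans R"
    using assms(1) by (auto elim: equivE)
  show "action_core K \<phi> R \<subseteq> S \<times> S"
    using R(1) by (auto simp: action_core_def)
  show "refl_on S (action_core K \<phi> R)"
    using R(2) assms(2) by (auto simp: action_core_def refl_on_def)
  show "sym (action_core K \<phi> R)"
    using R(3) by (auto simp: action_core_def sym_def)
  show "trans (action_core K \<phi> R)"
    using R(4) unfolding action_core_def trans_def by blast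
qed

lemma openin_action_core:
  assumes "compact_space K" and cont: "continuous_map (prod_topology K X) X (\<lambda>(k, x). \<phi> k x)"
    and R: "openin (prod_topology X X) R"
  shows "openin (prod_topology X X) (action_core (topspace K) \<phi> R)"
proof -
  let ?XX = "prod_topology X X"
  define W where "W = {z \<in> topspace (prod_topology K ?XX).
    (\<phi> (fst z) (fst (snd z)), \<phi> (fst z) (snd (snd z))) \<in> R}"
  have cont_action: "continuous_map (prod_topology K ?XX) X (\<lambda>z. \<phi> (fst z) (h (snd z)))"
    if "continuous_map ?XX X h" for h
  proof -
    have "continuous_map (prod_topology K ?XX) (prod_topology K X) (\<lambda>z. (fst z, h (snd z)))"
      using that by (intro continuous_map_pairedI continuous_map_fst
          continuous_map_compose[OF continuous_map_snd, unfolded o_def])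
    from continuous_map_compose[OF this cont] show ?thesis
      by (simp add: o_def)
  qed
  have "openin (prod_topology K ?XX) W"
    unfolding W_def
    using cont_action[OF continuous_map_fst] cont_action[OF continuous_map_snd]
    by (intro openin_continuous_map_preimage[OF _ R] continuous_map_pairedI)
  then have "openin ?XX (R \<inter> {z \<in> topspace ?XX. \<forall>k\<in>topspace K. (k, z) \<in> W})"
    using R assms(1) by (intro openin_Int openin_Collect_ball_compact_space)
  moreover have "R \<inter> {z \<in> topspace ?XX. \<forall>k\<in>topspace K. (k, z) \<in> W} = action_core (topspace K) \<phi> R"
    using openin_subset[OF R] by (auto simp: action_core_def W_def)
  ultimately show ?thesis by simp
qed

lemma openin_clopen_equiv:
  assumes "openin X U" "closedin X U"
  shows "openin (prod_topology X X) {(x, y) \<in> topspace X \<times> topspace X. x \<in> U \<longleftrightarrow> y \<in> U}"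
proof -
  have "openin (prod_topology X X) (U \<times> U \<union> (topspace X - U) \<times> (topspace X - U))"
    using assms by (intro openin_Un) (auto simp: openin_prod_Times_iff)
  moreover have "U \<times> U \<union> (topspace X - U) \<times> (topspace X - U)
    = {(x, y) \<in> topspace X \<times> topspace X. x \<in> U \<longleftrightarrow> y \<in> U}"
    using openin_subset[OF assms(1)] by auto
  ultimately show ?thesis by simp
qed

locale compact_semigroup =
  fixes X :: "'a topology" and f :: "'a \<Rightarrow> 'a \<Rightarrow> 'a"
  assumes topological_semigroup: "topological_semigroup X f" and compact: "compact_space X"
begin

lemma mult_closed: "x \<in> topspace X \<Longrightarrow> y \<in> topspace X \<Longrightarrow> f x y \<in> topspace X"
  using topological_semigroup by (simp add: topological_semigroup_def semigroup_on_def)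

lemma mult_assoc:
  "x \<in> topspace X \<Longrightarrow> y \<in> topspace X \<Longrightarrow> z \<in> topspace X \<Longrightarrow> f (f x y) z = f x (f y z)"
  using topological_semigroup by (simp add: topological_semigroup_def semigroup_on_def)

lemma continuous_map_mult: "continuous_map (prod_topology X X) X (\<lambda>(x, y). f x y)"
  using topological_semigroup by (simp add: topological_semigroup_def)

lemma continuous_map_mult_swap: "continuous_map (prod_topology X X) X (\<lambda>(x, y). f y x)"
proof -
  have "continuous_map (prod_topology X X) (prod_topology X X) (\<lambda>z. (snd z, fst z))"
    by (intro continuous_map_pairedI continuous_map_fst continuous_map_snd)
  from continuous_map_compose[OF this continuous_map_mult] show ?thesis
    by (simp add: o_def case_prod_unfold)
qed

definition open_congruences :: "('a \<times> 'a) set set" where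
  "open_congruences = {R. equiv (topspace X) R \<and> openin (prod_topology X X) R \<and>
     (\<forall>x y s t. (x, y) \<in> R \<longrightarrow> (s, t) \<in> R \<longrightarrow> (f x s, f y t) \<in> R)}"

lemma open_congruence_below:
  assumes eq: "equiv (topspace X) R" and "openin (prod_topology X X) R"
  obtains R' where "R' \<in> open_congruences" "R' \<subseteq> R"
proof
  let ?S = "topspace X"
  \<comment> \<open>By associativity, the core under right translations stays stable under left translations.\<close>
  define L where "L = action_core ?S f R"
  define R' where "R' = action_core ?S (\<lambda>s x. f x s) L"
  have "equiv ?S L"
    unfolding L_def using eq mult_closed by (rule equiv_action_core)
  then have eq': "equiv ?S R'"
    unfolding R'_def using mult_closed by (intro equiv_action_core)
  then have in_S: "x \<in> ?S \<and> y \<in> ?S" if "(x, y) \<in> R'" for x y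
    using that by (auto elim: equivE)
  have open_R': "openin (prod_topology X X) R'"
    unfolding R'_def L_def
    using compact continuous_map_mult continuous_map_mult_swap assms(2)
    by (intro openin_action_core)
  have left_L: "(f a x, f a y) \<in> L" if "(x, y) \<in> L" "a \<in> ?S" for a x y
  proof -
    have "x \<in> ?S" "y \<in> ?S"
      using that(1) \<open>equiv ?S L\<close> by (auto elim: equivE)
    with that show ?thesis
      by (simp add: L_def action_core_def mult_closed mult_assoc[symmetric])
  qed
  have left: "(f a x, f a y) \<in> R'" if "(x, y) \<in> R'" "a \<in> ?S" for a x y
    using that in_S[OF that(1)] left_L by (simp add: R'_def action_core_def mult_closed mult_assoc)
  have right: "(f x a, f y a) \<in> R'" if "(x, y) \<in> R'" "a \<in> ?S" for a x y
    using that in_S[OF that(1)] by (simp add: R'_def action_core_def mult_closed mult_assoc)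
  have "(f x s, f y t) \<in> R'" if "(x, y) \<in> R'" "(s, t) \<in> R'" for x y s t
    using right[OF that(1), of s] left[OF that(2), of y] in_S that eq'
    by (blast elim: equivE dest: transD)
  then show "R' \<in> open_congruences"
    using eq' open_R' by (simp add: open_congruences_def)
  show "R' \<subseteq> R"
    by (auto simp: R'_def L_def action_core_def)
qed

lemma open_congruence_separating:
  assumes "openin X U" "closedin X U" "x \<in> U" "y \<notin> U"
  obtains R where "R \<in> open_congruences" "(x, y) \<notin> R"
proof -
  let ?R = "{(x, y) \<in> topspace X \<times> topspace X. x \<in> U \<longleftrightarrow> y \<in> U}"
  have "equiv (topspace X) ?R"
    by (auto simp: equiv_def refl_on_def sym_def trans_def)
  then obtain R where "R \<in> open_congruences" "R \<subseteq> ?R"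
    using openin_clopen_equiv[OF assms(1,2)] by (rule open_congruence_below)
  with assms(3,4) show thesis
    by (blast intro: that)
qed

lemma Int_open_congruences:
  "R \<in> open_congruences \<Longrightarrow> R' \<in> open_congruences \<Longrightarrow> R \<inter> R' \<in> open_congruences"
  by (auto simp: open_congruences_def equiv_def openin_Int intro: sym_Int trans_Int
      refl_on_Int[of "topspace X" _ "topspace X", simplified])

lemma open_congruences_nonempty: "open_congruences \<noteq> {}"
proof -
  have "equiv (topspace X) (topspace X \<times> topspace X)"
    by (auto simp: equiv_def refl_on_def sym_def trans_def)
  then have "topspace X \<times> topspace X \<in> open_congruences"
    using mult_closed by (auto simp: open_congruences_def openin_prod_Times_iff)
  then show ?thesis by blast
qed

section \<open>Profinite semigroups\<close>

definition class_index :: "('a \<times> 'a) set \<Rightarrow> 'a \<Rightarrow> nat" where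
  "class_index R x = to_nat_on (topspace X // R) (R `` {x})"

definition class_representative :: "('a \<times> 'a) set \<Rightarrow> nat \<Rightarrow> 'a" where
  "class_representative R = inv_into (topspace X) (class_index R)"

definition quotient_carrier :: "('a \<times> 'a) set \<Rightarrow> nat set" where
  "quotient_carrier R = class_index R ` topspace X"

definition quotient_mult :: "('a \<times> 'a) set \<Rightarrow> nat \<Rightarrow> nat \<Rightarrow> nat" where
  "quotient_mult R a b = class_index R (f (class_representative R a) (class_representative R b))"

definition transition_map :: "('a \<times> 'a) set \<Rightarrow> ('a \<times> 'a) set \<Rightarrow> nat \<Rightarrow> nat" where
  "transition_map R R' a = class_index R (class_representative R' a)"

lemma class_index_eq_iff:
  assumes "R \<in> open_congruences" "x \<in> topspace X" "y \<in> topspace X"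
  shows "class_index R x = class_index R y \<longleftrightarrow> (x, y) \<in> R"
proof -
  have eq: "equiv (topspace X) R" and "openin (prod_topology X X) R"
    using assms(1) by (auto simp: open_congruences_def)
  then have "countable (topspace X // R)"
    using finite_quotient_if_openin[OF compact] by (simp add: countable_finite)
  then show ?thesis
    using assms(2,3) eq by (simp add: class_index_def quotientI eq_equiv_class_iff)
qed

lemma finite_quotient_carrier:
  assumes "R \<in> open_congruences"
  shows "finite (quotient_carrier R)"
proof -
  have "quotient_carrier R \<subseteq> to_nat_on (topspace X // R) ` (topspace X // R)"
    by (auto simp: quotient_carrier_def class_index_def quotientI)
  moreover have "finite (topspace X // R)"
    using assms compact by (auto simp: open_congruences_def intro: finite_quotient_if_openin)
  ultimately show ?thesis
    by (meson finite_imageI finite_subset)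
qed

lemma class_representative_class_index:
  assumes "R \<in> open_congruences" "x \<in> topspace X"
  shows "class_representative R (class_index R x) \<in> topspace X"
    and "(class_representative R (class_index R x), x) \<in> R"
proof -
  have "class_index R x \<in> class_index R ` topspace X"
    using assms(2) by blast
  then show "class_representative R (class_index R x) \<in> topspace X"
    and "(class_representative R (class_index R x), x) \<in> R"
    unfolding class_representative_def using assms
    by (auto simp: class_index_eq_iff[symmetric] inv_into_into f_inv_into_f)
qed

lemma quotient_mult_class_index:
  assumes "R \<in> open_congruences" "x \<in> topspace X" "y \<in> topspace X"
  shows "quotient_mult R (class_index R x) (class_index R y) = class_index R (f x y)"
proof -
  have "(f (class_representative R (class_index R x)) (class_representative R (class_index R y)),
      f x y) \<in> R"
    using assms class_representative_class_index by (simp add: open_congruences_def)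
  then show ?thesis
    using assms class_representative_class_index
    by (simp add: quotient_mult_def class_index_eq_iff mult_closed)
qed

lemma transition_map_class_index:
  assumes "R \<in> open_congruences" "R' \<in> open_congruences" "R' \<subseteq> R" "x \<in> topspace X"
  shows "transition_map R R' (class_index R' x) = class_index R x"
  using assms class_representative_class_index[OF assms(2,4)]
  by (auto simp: transition_map_def class_index_eq_iff)

lemma semigroup_on_quotient:
  "R \<in> open_congruences \<Longrightarrow> semigroup_on (quotient_carrier R) (quotient_mult R)"
  by (auto simp: semigroup_on_def quotient_carrier_def quotient_mult_class_index
      mult_closed mult_assoc)

lemma semigroup_hom_on_class_index:
  "R \<in> open_congruences \<Longrightarrow>
    semigroup_hom_on (topspace X) f (quotient_carrier R) (quotient_mult R) (class_index R)"
  by (auto simp: semigroup_hom_on_def quotient_carrier_def quotient_mult_class_index)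

lemma continuous_map_class_index:
  assumes "R \<in> open_congruences"
  shows "continuous_map X (discrete_topology (quotient_carrier R)) (class_index R)"
proof -
  have R: "equiv (topspace X) R" "openin (prod_topology X X) R"
    using assms by (auto simp: open_congruences_def)
  have "openin X {x \<in> topspace X. class_index R x \<in> A}" for A
  proof -
    have "{x \<in> topspace X. class_index R x \<in> A} =
        (\<Union>x\<in>{x \<in> topspace X. class_index R x \<in> A}. R `` {x})"
      using class_index_eq_iff[OF assms] R(1) by (force elim!: equivE dest: refl_onD)
    moreover have "openin X (\<Union>x\<in>{x \<in> topspace X. class_index R x \<in> A}. R `` {x})"
      using openin_equiv_class[OF R(2)] by blast
    ultimately show ?thesis by simp
  qed
  then show ?thesis
    by (auto simp: continuous_map_def quotient_carrier_def)
qed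

lemma finite_semigroup_inverse_system_quotients:
  "finite_semigroup_inverse_system open_congruences (\<supseteq>) quotient_carrier quotient_mult
    transition_map"
proof
  show "\<exists>R''\<in>open_congruences. R'' \<subseteq> R \<and> R'' \<subseteq> R'"
    if "R \<in> open_congruences" "R' \<in> open_congruences" for R R'
    using Int_open_congruences[OF that] by blast
  show "semigroup_hom_on (quotient_carrier R') (quotient_mult R') (quotient_carrier R)
      (quotient_mult R) (transition_map R R')"
    if "R \<in> open_congruences" "R' \<in> open_congruences" "R' \<subseteq> R" for R R'
    using that by (auto simp: semigroup_hom_on_def quotient_carrier_def quotient_mult_class_index
        transition_map_class_index mult_closed)
  show "finite (quotient_carrier R)" "semigroup_on (quotient_carrier R) (quotient_mult R)"
    if "R \<in> open_congruences" for R
    using that by (rule finite_quotient_carrier, rule semigroup_on_quotient)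
qed (auto simp: open_congruences_nonempty quotient_carrier_def transition_map_class_index)

theorem profinite_semigroup_if_totally_disconnected:
  assumes "Hausdorff_space X" and disconnected: "\<And>x y. connected_component_of X x y \<Longrightarrow> x = y"
  shows "profinite_semigroup X f"
proof -
  interpret quotients: finite_semigroup_inverse_system open_congruences "(\<supseteq>)" quotient_carrier
    quotient_mult transition_map
    by (rule finite_semigroup_inverse_system_quotients)
  have "\<exists>R\<in>open_congruences. class_index R x \<noteq> class_index R y"
    if xy: "x \<in> topspace X" "y \<in> topspace X" "x \<noteq> y" for x y
  proof -
    have "quasi_component_of X x = connected_component_of X x"
      using compact assms(1) by (intro quasi_eq_connected_component_of) blast
    then have "\<not> quasi_component_of X x y"
      using disconnected xy(3) by metis
    then obtain U where "openin X U" "closedin X U" "x \<in> U \<longleftrightarrow> y \<notin> U"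
      using xy(1,2) by (auto simp: quasi_component_of_def)
    then obtain V where "openin X V" "closedin X V" "x \<in> V" "y \<notin> V"
      using xy(1)
      by (metis DiffI DiffD2 closedin_diff closedin_topspace openin_diff openin_topspace)
    then obtain R where "R \<in> open_congruences" "(x, y) \<notin> R"
      by (rule open_congruence_separating)
    then show ?thesis
      using class_index_eq_iff xy(1,2) by blast
  qed
  then have "homeomorphic_map X
      (projective_limit_topology open_congruences (\<supseteq>) quotient_carrier transition_map)
      (\<lambda>x. \<lambda>R\<in>open_congruences. class_index R x)"
    by (intro quotients.homeomorphic_map_projective_limit compact continuous_map_class_index
        transition_map_class_index) (auto simp: quotient_carrier_def)
  moreover have "semigroup_hom_on (topspace X) f
      (projective_limit open_congruences (\<supseteq>) quotient_carrier transition_map)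
      (projective_limit_mult open_congruences quotient_mult)
      (\<lambda>x. \<lambda>R\<in>open_congruences. class_index R x)"
    by (intro quotients.semigroup_hom_on_projective_limit
        semigroup_hom_on_class_index transition_map_class_index)
  ultimately show ?thesis
    unfolding profinite_semigroup_def
    using topological_semigroup finite_semigroup_inverse_system_quotients by blast
qed

end

section \<open>Closures of semigroups of domestic matrices\<close>

lemma countable_imp_totally_disconnected:
  fixes S :: "'a::metric_space set"
  assumes "countable S" "connected_component_of (top_of_set S) x y"
  shows "x = y"
proof -
  obtain C where "connected C" "C \<subseteq> S" "x \<in> C" "y \<in> C"
    using assms(2) by (auto simp: connected_component_of_def connectedin_subtopology)
  then show ?thesis
    using connected_uncountable assms(1) countable_subset by metis
qed

lemma topological_semigroup_closure_generated_semigroup: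
  "topological_semigroup (top_of_set (closure (generated_semigroup N))) (**)"
  using closure_generated_semigroup_mult
  by (auto simp: topological_semigroup_def semigroup_on_def matrix_mul_assoc case_prod_unfold
      intro!: continuous_intros)

theorem corollary5p10:
  fixes \<epsilon> :: real and \<M> :: "(real ^ 'n ^ 'n) set"
  assumes "0 < \<epsilon>" and "\<epsilon> \<le> 1 / (2 * real CARD('n))"
    and "finite \<M>" and "\<M> \<subseteq> domestic_matrices \<epsilon>"
  shows "finitely_generated (closure (generated_semigroup \<M>)) \<and>
    profinite_semigroup (top_of_set (closure (generated_semigroup \<M>))) (**)"
proof
  let ?S = "closure (generated_semigroup \<M>)"
  have para: "\<M> \<subseteq> paracontracting_matrices"
    using assms(4) domestic_subset_paracontracting[OF assms(1)] by blast
  then show "finitely_generated ?S"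
    by (rule finitely_generated_closure_paracontracting[OF assms(3)])
  then have "countable ?S"
    by (metis finitely_generated_def countable_generated_semigroup countable_finite)
  have "compact ?S"
    using para paracontracting_subset_nonexpansive
    by (intro compact_closure_generated_semigroup) blast
  then interpret compact_semigroup "top_of_set ?S" "(**)"
    by unfold_locales
      (simp_all add: topological_semigroup_closure_generated_semigroup compact_space_subtopology)
  show "profinite_semigroup (top_of_set ?S) (**)"
    using countable_imp_totally_disconnected[OF \<open>countable ?S\<close>]
    by (intro profinite_semigroup_if_totally_disconnected) (auto intro: Hausdorff_space_subtopology)
qed

end
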